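(* Let $G$ be an amenable topological group with no non-trivial continuous homomorphisms $G\to\mathbb{R}$ and let $\alpha: G\curvearrowright V$ be a continuous affine isometric action on a Banach space $V$ with associated linear isometric action $\pi:G\curvearrowright V$. Let $V_G=\overline{\mathrm{span}}\{v-\pi(g)v\mid v\in V,\ g\in G\}$. Then, for any finite collection $C_1,\ldots,C_n$ of non-empty convex $\alpha$-invariant subsets of $V_G$ and any $\epsilon>0$, there is some $v\in V_G$ such that $$\max_{1\le i\le n}\ \mathrm{dist}(v,C_i)<\epsilon.$$
   Context: A topological group $G$ is amenable if every continuous affine action of $G$ on a non-empty compact convex subset of a locally convex topological vector space has a fixed point. Equivalently, there is a mean $\mathfrak m$ (positive linear functional of norm $1$ with $\mathfrak m(\mathbf 1)=1$) on the algebra $\mathsf{LUCB}(G)$ of bounded functions $\phi:G\to\mathbb R$ for which $g\mapsto\phi(\,\cdot\,g)$ is continuous in the sup norm, such that $\mathfrak m(\phi(\,\cdot\, g))=\mathfrak m(\phi)$ for all $g\in G$. Banach spaces are real. Every continuous action $\alpha$ of $G$ by affine isometries on $V$ decomposes uniquely as $\alpha(g)v=\pi(g)v+b(g)$, where $\pi:G\curvearrowright V$ is a strongly continuous linear isometric action and $b:G\to V$ is continuous (a cocycle). The closed span is in the norm topology. *)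

theory Defs
  imports "HOL-Analysis.Analysis"
begin

text \<open>
  Topological groups are the library's \<^class>\<open>topological_group_add\<close>. The group law is written
  additively but is not assumed commutative (nor the topology Hausdorff): \<open>x + g\<close> stands for the
  product \<open>xg\<close>, \<open>0\<close> for the identity and \<open>- g\<close> for the inverse.
\<close>

text \<open>
  For bounded \<open>\<phi>\<close>, uniform convergence of the right translates is convergence in the sup norm, so the
  second condition is sup-norm continuity of \<open>g \<mapsto> \<phi>(\<cdot>g)\<close> at every \<open>g\<close>.
\<close>

definition LUCB :: "('g::topological_group_add \<Rightarrow> real) set" where
  "LUCB = {\<phi>. bounded (range \<phi>) \<and>
              (\<forall>g. uniform_limit UNIV (\<lambda>h x. \<phi> (x + h)) (\<lambda>x. \<phi> (x + g)) (nhds g))}"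

text \<open>
  Only the values of a mean on \<^const>\<open>LUCB\<close> matter. The last two conditions together express that
  the functional has norm 1 and takes the value 1 at the constant function 1.
\<close>

definition mean_on_LUCB :: "(('g::topological_group_add \<Rightarrow> real) \<Rightarrow> real) \<Rightarrow> bool" where
  "mean_on_LUCB m \<longleftrightarrow>
     (\<forall>\<phi>\<in>LUCB. \<forall>\<psi>\<in>LUCB. m (\<lambda>x. \<phi> x + \<psi> x) = m \<phi> + m \<psi>) \<and>
     (\<forall>c. \<forall>\<phi>\<in>LUCB. m (\<lambda>x. c * \<phi> x) = c * m \<phi>) \<and>
     (\<forall>\<phi>\<in>LUCB. (\<forall>x. 0 \<le> \<phi> x) \<longrightarrow> 0 \<le> m \<phi>) \<and>
     (\<forall>\<phi>\<in>LUCB. \<bar>m \<phi>\<bar> \<le> (SUP x. \<bar>\<phi> x\<bar>)) \<and>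
     m (\<lambda>x. 1) = 1"

text \<open>
  Amenability in its invariant-mean form. The equivalent fixed-point form quantifies over all
  locally convex topological vector spaces, hence over types, and cannot be a HOL predicate.
  The type argument only selects the group.
\<close>

definition amenable :: "'g::topological_group_add itself \<Rightarrow> bool" where
  "amenable _ \<longleftrightarrow>
     (\<exists>m :: ('g \<Rightarrow> real) \<Rightarrow> real. mean_on_LUCB m \<and>
        (\<forall>\<phi>\<in>LUCB. \<forall>g. m (\<lambda>x. \<phi> (x + g)) = m \<phi>))"

definition continuous_hom_to_real :: "('g::topological_group_add \<Rightarrow> real) \<Rightarrow> bool" where
  "continuous_hom_to_real h \<longleftrightarrow> continuous_on UNIV h \<and> (\<forall>x y. h (x + y) = h x + h y)"

definition is_group_action :: "('g::group_add \<Rightarrow> 'v \<Rightarrow> 'v) \<Rightarrow> bool" where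
  "is_group_action \<alpha> \<longleftrightarrow> (\<forall>v. \<alpha> 0 v = v) \<and> (\<forall>g h v. \<alpha> (g + h) v = \<alpha> g (\<alpha> h v))"

definition affine_isometry :: "('v::real_normed_vector \<Rightarrow> 'v) \<Rightarrow> bool" where
  "affine_isometry f \<longleftrightarrow>
     (\<forall>u v t. f ((1 - t) *\<^sub>R u + t *\<^sub>R v) = (1 - t) *\<^sub>R f u + t *\<^sub>R f v) \<and>
     (\<forall>u v. dist (f u) (f v) = dist u v)"

definition continuous_affine_isometric_action ::
    "('g::topological_group_add \<Rightarrow> 'v::banach \<Rightarrow> 'v) \<Rightarrow> bool" where
  "continuous_affine_isometric_action \<alpha> \<longleftrightarrow>
     is_group_action \<alpha> \<and> (\<forall>g. affine_isometry (\<alpha> g)) \<and>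
     continuous_on UNIV (\<lambda>(g, v). \<alpha> g v)"

definition linear_isometric_action ::
    "('g::topological_group_add \<Rightarrow> 'v::banach \<Rightarrow> 'v) \<Rightarrow> bool" where
  "linear_isometric_action \<pi> \<longleftrightarrow>
     is_group_action \<pi> \<and> (\<forall>g. linear (\<pi> g)) \<and> (\<forall>g v. norm (\<pi> g v) = norm v) \<and>
     (\<forall>v. continuous_on UNIV (\<lambda>g. \<pi> g v))"

definition associated_linear_action ::
    "('g::topological_group_add \<Rightarrow> 'v::banach \<Rightarrow> 'v) \<Rightarrow> ('g \<Rightarrow> 'v \<Rightarrow> 'v) \<Rightarrow> bool" where
  "associated_linear_action \<alpha> \<pi> \<longleftrightarrow>
     linear_isometric_action \<pi> \<and>
     (\<exists>b. continuous_on UNIV b \<and> (\<forall>g v. \<alpha> g v = \<pi> g v + b g))"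

lemma ex1_associated_linear_action:
  fixes \<alpha> :: "'g::topological_group_add \<Rightarrow> 'v::banach \<Rightarrow> 'v"
  assumes "continuous_affine_isometric_action \<alpha>"
  shows "\<exists>!\<pi>. associated_linear_action \<alpha> \<pi>"
proof (rule ex1I)
  let ?p = "\<lambda>g v. \<alpha> g v - \<alpha> g 0"
  have act0: "\<alpha> 0 v = v" and act: "\<alpha> (g + h) v = \<alpha> g (\<alpha> h v)" for g h v
    using assms by (auto simp: continuous_affine_isometric_action_def is_group_action_def)
  have aff: "\<alpha> g ((1 - t) *\<^sub>R u + t *\<^sub>R v) = (1 - t) *\<^sub>R \<alpha> g u + t *\<^sub>R \<alpha> g v"
    and iso: "dist (\<alpha> g u) (\<alpha> g v) = dist u v" for g u v t
    using assms by (auto simp: continuous_affine_isometric_action_def affine_isometry_def)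
  have cont: "continuous_on UNIV (\<lambda>g. \<alpha> g v)" for v
  proof -
    have "continuous_on UNIV (\<lambda>(g, v). \<alpha> g v)"
      using assms by (simp add: continuous_affine_isometric_action_def)
    moreover have "continuous_on UNIV (\<lambda>g::'g. (g, v))"
      by (intro continuous_on_Pair continuous_on_id continuous_on_const)
    ultimately have "continuous_on UNIV (\<lambda>g. case (g, v) of (g, v) \<Rightarrow> \<alpha> g v)"
      by (rule continuous_on_compose2) simp
    then show ?thesis by simp
  qed
  have scale: "?p g (t *\<^sub>R v) = t *\<^sub>R ?p g v" for g t v
    using aff[of g t 0 v] by (simp add: algebra_simps)
  have add: "?p g (u + v) = ?p g u + ?p g v" for g u v
  proof -
    have "(1/2) *\<^sub>R ?p g (u + v) = ?p g ((1/2) *\<^sub>R (u + v))"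
      by (rule scale[symmetric])
    also have "\<dots> = (1/2) *\<^sub>R (?p g u + ?p g v)"
      using aff[of g "1/2" u v] scaleR_half_double[of "\<alpha> g 0"]
      by (simp add: algebra_simps)
    finally show ?thesis by simp
  qed
  have lin: "linear (?p g)" for g
    using add scale by (intro linearI) auto
  have "?p (g + h) v = ?p g (?p h v)" for g h v
    using linear_diff[OF lin[of g], of "\<alpha> h v" "\<alpha> h 0"] by (simp add: act)
  moreover have "norm (?p g v) = norm v" for g v
    using iso[of g v 0] by (simp add: dist_norm)
  ultimately have "linear_isometric_action ?p"
    using lin unfolding linear_isometric_action_def is_group_action_def
    by (auto simp: act0 intro!: continuous_intros cont)
  then show "associated_linear_action \<alpha> ?p"
    unfolding associated_linear_action_def
    using cont[of 0] by (auto intro!: exI[of _ "\<lambda>g. \<alpha> g 0"])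
  fix \<pi> assume "associated_linear_action \<alpha> \<pi>"
  then obtain b where lin': "\<And>g. linear (\<pi> g)" and dec: "\<And>g v. \<alpha> g v = \<pi> g v + b g"
    unfolding associated_linear_action_def linear_isometric_action_def by auto
  show "\<pi> = ?p"
    by (intro ext) (simp add: dec linear_0[OF lin'])
qed

definition coboundary_space :: "('g \<Rightarrow> 'v::banach \<Rightarrow> 'v) \<Rightarrow> 'v set" where
  "coboundary_space \<pi> = closure (span {v - \<pi> g v | v g. True})"

definition action_invariant :: "('g \<Rightarrow> 'v \<Rightarrow> 'v) \<Rightarrow> 'v set \<Rightarrow> bool" where
  "action_invariant \<alpha> C \<longleftrightarrow> (\<forall>g. \<alpha> g ` C \<subseteq> C)"

end

theory Submission imports Defs begin

text \<open>
  If every point of a convex \<open>\<pi>\<close>-invariant set \<open>K\<close> of the closed span of the coboundaries had norm at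
  least \<open>d > 0\<close>, Hahn--Banach would give a bounded functional \<open>f \<ge> d\<close> on \<open>K\<close>, and for \<open>k \<in> K\<close> the
  invariant mean of \<open>g \<mapsto> f (\<pi> g k)\<close> would be at least \<open>d\<close>. But the mean of \<open>g \<mapsto> f (\<pi> g w)\<close> is
  bounded and linear in \<open>w\<close> and vanishes on coboundaries. Applied to \<open>K = C - D\<close>, this shows that
  two convex \<open>\<alpha>\<close>-invariant sets have distance 0. Since the points of \<open>C\<close> at distance less than \<open>\<epsilon>\<close>
  from \<open>D\<close> again form such a set, induction handles finitely many.
\<close>

section \<open>Separation by a linear functional\<close>

text \<open>Homogeneity is demanded only as an inequality, the half that is easiest to check for an
  infimum; \<open>sublinear_scaleR\<close> recovers equality by applying it to the inverse
  scalar.\<close>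

definition sublinear :: "('a::real_vector \<Rightarrow> real) \<Rightarrow> bool" where
  "sublinear p \<longleftrightarrow> (\<forall>x y. p (x + y) \<le> p x + p y) \<and> (\<forall>t\<ge>0. \<forall>x. p (t *\<^sub>R x) \<le> t * p x)"

lemma sublinear_add: "sublinear p \<Longrightarrow> p (x + y) \<le> p x + p y"
  by (simp add: sublinear_def)

lemma sublinear_zero:
  assumes "sublinear p" shows "p 0 = 0"
proof -
  have "p (0 *\<^sub>R 0) \<le> 0 * p 0"
    using assms unfolding sublinear_def by blast
  then show ?thesis
    using sublinear_add[OF assms, of 0 0] by simp
qed

lemma sublinear_scaleR:
  assumes "sublinear p" "t \<ge> 0" shows "p (t *\<^sub>R x) = t * p x"
proof (cases "t = 0")
  case True
  then show ?thesis using sublinear_zero[OF assms(1)] by simp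
next
  case False
  have le: "p (t *\<^sub>R x) \<le> t * p x" if "t \<ge> 0" for t x
    using assms(1) that by (simp add: sublinear_def)
  have "p (inverse t *\<^sub>R (t *\<^sub>R x)) \<le> inverse t * p (t *\<^sub>R x)"
    using assms(2) by (intro le) simp
  then have "t * p x \<le> p (t *\<^sub>R x)"
    using False assms(2) by (simp add: field_simps)
  with le[OF assms(2)] show ?thesis by (simp add: antisym)
qed

lemma sublinear_minus:
  assumes "sublinear p" shows "- p (- x) \<le> p x"
  using sublinear_add[OF assms, of x "- x"] sublinear_zero[OF assms] by simp

text \<open>Common core of the three infimum constructions below. Good indices for x and for y may
  differ, so \<open>add\<close> asks for some index doing as well at x + y; minimising over s' and
  then over s gives subadditivity. The bound \<open>bdd\<close> makes the real-valued
  \<open>INF\<close> a genuine infimum.\<close>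

lemma sublinear_INF:
  assumes "S \<noteq> {}"
    and bdd: "\<And>x. bdd_below ((\<lambda>s. F s x) ` S)"
    and add: "\<And>s s' x y. s \<in> S \<Longrightarrow> s' \<in> S \<Longrightarrow> \<exists>r\<in>S. F r (x + y) \<le> F s x + F s' y"
    and scale: "\<And>s t x. s \<in> S \<Longrightarrow> t \<ge> 0 \<Longrightarrow> \<exists>r\<in>S. F r (t *\<^sub>R x) \<le> t * F s x"
  shows "sublinear (\<lambda>x. INF s\<in>S. F s x)"
proof -
  let ?u = "\<lambda>x. INF s\<in>S. F s x"
  have lower: "?u x \<le> F s x" if "s \<in> S" for s x
    using bdd that by (rule cINF_lower)
  have "?u (x + y) \<le> ?u x + ?u y" for x y
  proof -
    have "?u (x + y) \<le> F s x + F s' y" if "s \<in> S" "s' \<in> S" for s s'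
      using add[OF that, of x y] lower[of _ "x + y"] by fastforce
    then have "?u (x + y) - F s x \<le> F s' y" if "s \<in> S" "s' \<in> S" for s s'
      using that by (fastforce simp: diff_le_eq add.commute)
    then have "?u (x + y) - F s x \<le> ?u y" if "s \<in> S" for s
      using that assms(1) by (intro cINF_greatest) auto
    then have "?u (x + y) - ?u y \<le> ?u x"
      using assms(1) by (intro cINF_greatest) (simp_all add: algebra_simps)
    then show ?thesis by simp
  qed
  moreover have "?u (t *\<^sub>R x) \<le> t * ?u x" if "t \<ge> 0" for t x
  proof -
    have le: "?u (t *\<^sub>R x) \<le> t * F s x" if "s \<in> S" for s
      using scale[OF that \<open>t \<ge> 0\<close>, of x] lower[of _ "t *\<^sub>R x"] by fastforce
    show ?thesis
    proof (cases "t = 0")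
      case True
      then show ?thesis using le assms(1) by auto
    next
      case False
      with \<open>t \<ge> 0\<close> have "t > 0" by simp
      then have "?u (t *\<^sub>R x) / t \<le> ?u x"
        using assms(1) le by (intro cINF_greatest) (auto simp: field_simps)
      with \<open>t > 0\<close> show ?thesis by (simp add: field_simps)
    qed
  qed
  ultimately show ?thesis by (simp add: sublinear_def)
qed

text \<open>For fixed y, the infimum of q(x + t y) - t q(y) over t \<ge> 0 is a sublinear functional
  of x lying below q. Minimality makes it equal to q, and t = 1 then yields the missing
  superadditivity.\<close>

lemma minimal_sublinear_imp_linear:
  assumes q: "sublinear q"
    and min: "\<And>r. sublinear r \<Longrightarrow> r \<le> q \<Longrightarrow> r = q"
  shows "linear q"
proof -
  have super: "q x + q y \<le> q (x + y)" for x y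
  proof -
    define F where "F t x = q (x + t *\<^sub>R y) - t * q y" for t x
    define r where "r x = (INF t\<in>{0..}. F t x)" for x
    have bdd: "bdd_below ((\<lambda>t. F t x) ` {0..})" for x
    proof (rule bdd_belowI2)
      fix t :: real assume "t \<in> {0..}"
      \<comment> \<open>Writing t y as (x + t y) - x gives a lower bound that does not depend on
        t.\<close>
      then have "t * q y \<le> q (x + t *\<^sub>R y) + q (- x)"
        using sublinear_add[OF q, of "x + t *\<^sub>R y" "- x"] sublinear_scaleR[OF q, of t y] by simp
      then show "- q (- x) \<le> F t x" by (simp add: F_def)
    qed
    have "sublinear r"
      unfolding r_def
    proof (rule sublinear_INF)
      fix s s' x x' assume "s \<in> {0::real..}" "s' \<in> {0::real..}"
      then have "F (s + s') (x + x') \<le> F s x + F s' x'"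
        using sublinear_add[OF q, of "x + s *\<^sub>R y" "x' + s' *\<^sub>R y"]
        by (simp add: F_def algebra_simps)
      then show "\<exists>t\<in>{0..}. F t (x + x') \<le> F s x + F s' x'"
        using \<open>s \<in> _\<close> \<open>s' \<in> _\<close> by (intro bexI[of _ "s + s'"]) auto
    next
      fix s t :: real and x assume "s \<in> {0..}" "t \<ge> 0"
      then have "F (t * s) (t *\<^sub>R x) \<le> t * F s x"
        using sublinear_scaleR[OF q, of t "x + s *\<^sub>R y"]
        by (simp add: F_def algebra_simps)
      then show "\<exists>r\<in>{0..}. F r (t *\<^sub>R x) \<le> t * F s x"
        using \<open>s \<in> _\<close> \<open>t \<ge> 0\<close> by (intro bexI[of _ "t * s"]) auto
    qed (use bdd in auto)
    have lower: "r x \<le> F t x" if "t \<ge> 0" for t x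
      unfolding r_def using bdd that by (intro cINF_lower) auto
    \<comment> \<open>The parameter t = 0 gives back q itself.\<close>
    have "r \<le> q"
      using lower[of 0] by (auto simp: F_def le_fun_def)
    with \<open>sublinear r\<close> min have "r = q" by blast
    then show ?thesis
      using lower[of 1 x] by (simp add: F_def)
  qed
  have add: "q (x + y) = q x + q y" for x y
    using super sublinear_add[OF q] by (simp add: antisym)
  have neg: "q (- x) = - q x" for x
    using add[of x "- x"] sublinear_zero[OF q] by simp
  have "q (t *\<^sub>R x) = t * q x" for t x
  proof (cases "t \<ge> 0")
    case True
    then show ?thesis by (rule sublinear_scaleR[OF q])
  next
    case False
    then show ?thesis
      using sublinear_scaleR[OF q, of "- t" x] neg[of "t *\<^sub>R x"] by simp
  qed
  then show ?thesis
    using add by (intro linearI) auto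
qed

text \<open>Zorn's lemma provides a minimal element among the sublinear functionals below p, and a
  minimal one is linear.\<close>

theorem hahn_banach_sublinear:
  fixes p :: "'a::real_vector \<Rightarrow> real"
  assumes p: "sublinear p"
  shows "\<exists>f. linear f \<and> (\<forall>x. f x \<le> p x)"
proof -
  define A where "A = {q. sublinear q \<and> q \<le> p}"
  \<comment> \<open>Zorn's lemma yields maximal elements, so the order is reversed: an upper bound
    of a chain in \<open>R\<close> is a pointwise lower bound.\<close>
  define R where "R = relation_of (\<ge>) A"
  have "partial_order_on A R"
    unfolding R_def by (rule partial_order_on_relation_ofI) auto
  moreover have "\<exists>u\<in>A. \<forall>q\<in>\<C>. u \<le> q" if "\<C> \<in> Chains R" for \<C>
  proof (cases "\<C> = {}")
    case True
    then show ?thesis using p by (auto simp: A_def)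
  next
    case False
    have C: "sublinear q" "q \<le> p" if "q \<in> \<C>" for q
      using \<open>\<C> \<in> Chains R\<close> that by (auto simp: Chains_def R_def relation_of_def A_def)
    have total: "q \<le> q' \<or> q' \<le> q" if "q \<in> \<C>" "q' \<in> \<C>" for q q'
      using \<open>\<C> \<in> Chains R\<close> that by (auto simp: Chains_def R_def relation_of_def)
    define u where "u x = (INF q\<in>\<C>. q x)" for x
    have bdd: "bdd_below ((\<lambda>q. q x) ` \<C>)" for x
    proof (rule bdd_belowI2)
      fix q assume "q \<in> \<C>"
      \<comment> \<open>This bound is the same for all members of the chain.\<close>
      then show "- p (- x) \<le> q x"
        using sublinear_minus[OF C(1), of q x] le_funD[OF C(2), of q "- x"] by simp
    qed
    have "sublinear u"
      unfolding u_def
    proof (rule sublinear_INF)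
      fix s s' x y assume s: "s \<in> \<C>" "s' \<in> \<C>"
      \<comment> \<open>In a chain, the smaller of two functionals serves for both
        arguments.\<close>
      define r where "r = (if s \<le> s' then s else s')"
      have "r \<in> \<C>" "r \<le> s" "r \<le> s'" using s total by (auto simp: r_def)
      moreover have "r (x + y) \<le> r x + r y"
        using \<open>r \<in> \<C>\<close> by (intro sublinear_add C)
      moreover have "r x \<le> s x" "r y \<le> s' y"
        using \<open>r \<le> s\<close> \<open>r \<le> s'\<close> by (auto simp: le_fun_def)
      ultimately show "\<exists>r\<in>\<C>. r (x + y) \<le> s x + s' y"
        by (intro bexI[of _ r]) auto
    next
      fix s and t :: real and x assume "s \<in> \<C>" "t \<ge> 0"
      then show "\<exists>r\<in>\<C>. r (t *\<^sub>R x) \<le> t * s x"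
        using sublinear_scaleR[OF C(1), of s t x] by (intro bexI[of _ s]) auto
    qed (use False bdd in auto)
    moreover have lower: "u \<le> q" if "q \<in> \<C>" for q
      unfolding u_def le_fun_def using bdd that by (auto intro: cINF_lower)
    moreover have "u \<le> p"
      using False lower C(2) by (meson ex_in_conv order_trans)
    ultimately show ?thesis by (auto simp: A_def)
  qed
  ultimately have "\<exists>q\<in>A. \<forall>r\<in>A. q \<ge> r \<longrightarrow> r = q"
    unfolding R_def by (rule predicate_Zorn)
  then obtain q where "sublinear q" "q \<le> p" and min: "\<And>r. r \<in> A \<Longrightarrow> r \<le> q \<Longrightarrow> r = q"
    by (auto simp: A_def)
  have "linear q"
    using \<open>sublinear q\<close>
  proof (rule minimal_sublinear_imp_linear)
    fix r assume "sublinear r" "r \<le> q"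
    then show "r = q"
      using \<open>q \<le> p\<close> by (intro min) (auto simp: A_def)
  qed
  with \<open>q \<le> p\<close> show ?thesis by (auto simp: le_fun_def)
qed

text \<open>Hahn--Banach is applied to the infimum of |x + t k| - t d over t \<ge> 0 and k in K,
  which is at least -|x| because t d \<le> |t k|. Taking t = 0 bounds f by the norm; taking t = 1
  and x = -k gives f(-k) \<le> -d.\<close>

lemma separate_convex_from_ball:
  fixes K :: "'a::real_normed_vector set"
  assumes "convex K" "K \<noteq> {}" and far: "\<And>k. k \<in> K \<Longrightarrow> d \<le> norm k"
  obtains f where "linear f" "\<And>x. \<bar>f x\<bar> \<le> norm x" "\<And>k. k \<in> K \<Longrightarrow> d \<le> f k"
proof -
  let ?S = "{0::real..} \<times> K"
  define F where "F = (\<lambda>(t, k) (x::'a). norm (x + t *\<^sub>R k) - t * d)"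
  define p where "p x = (INF s\<in>?S. F s x)" for x
  have bdd: "bdd_below ((\<lambda>s. F s x) ` ?S)" for x
  proof (rule bdd_belowI2)
    fix s assume "s \<in> ?S"
    then obtain t k where s: "s = (t, k)" "t \<ge> 0" "k \<in> K" by auto
    have "t * d \<le> norm (t *\<^sub>R k)"
      using s far by (simp add: mult_left_mono)
    also have "\<dots> \<le> norm (x + t *\<^sub>R k) + norm x"
      using norm_triangle_ineq4[of "x + t *\<^sub>R k" x] by simp
    finally show "- norm x \<le> F s x" by (simp add: F_def s)
  qed
  have "sublinear p"
    unfolding p_def
  proof (rule sublinear_INF)
    fix s s' x y assume "s \<in> ?S" "s' \<in> ?S"
    then obtain t k t' k' where s: "s = (t, k)" "t \<ge> 0" "k \<in> K" "s' = (t', k')" "t' \<ge> 0" "k' \<in> K"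
      by auto
    \<comment> \<open>The combined index is the average of k and k' with weights t and t', in K by
      convexity. If both weights vanish, any point of K will do.\<close>
    obtain l where l: "l \<in> K" "(t + t') *\<^sub>R l = t *\<^sub>R k + t' *\<^sub>R k'"
    proof (cases "t + t' = 0")
      case True
      with s have "t = 0" "t' = 0" by auto
      with s that show ?thesis by simp
    next
      case False
      show ?thesis
      proof
        show "(t / (t + t')) *\<^sub>R k + (t' / (t + t')) *\<^sub>R k' \<in> K"
          using s False
          by (intro convexD[OF \<open>convex K\<close>]) (auto simp: add_divide_distrib[symmetric])
      qed (use False in \<open>simp add: scaleR_right_distrib\<close>)
    qed
    have "x + y + (t + t') *\<^sub>R l = (x + t *\<^sub>R k) + (y + t' *\<^sub>R k')"
      using l by simp
    then have "F (t + t', l) (x + y) \<le> F s x + F s' y"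
      using norm_triangle_ineq[of "x + t *\<^sub>R k" "y + t' *\<^sub>R k'"]
      by (simp add: F_def s algebra_simps)
    then show "\<exists>r\<in>?S. F r (x + y) \<le> F s x + F s' y"
      using s l by (intro bexI[of _ "(t + t', l)"]) auto
  next
    fix s and t :: real and x assume "s \<in> ?S" "t \<ge> 0"
    then obtain u k where s: "s = (u, k)" "u \<ge> 0" "k \<in> K" by auto
    have "t *\<^sub>R x + (t * u) *\<^sub>R k = t *\<^sub>R (x + u *\<^sub>R k)"
      by (simp add: algebra_simps)
    then have "F (t * u, k) (t *\<^sub>R x) \<le> t * F s x"
      using \<open>t \<ge> 0\<close> by (simp add: F_def s right_diff_distrib)
    then show "\<exists>r\<in>?S. F r (t *\<^sub>R x) \<le> t * F s x"
      using s \<open>t \<ge> 0\<close> by (intro bexI[of _ "(t * u, k)"]) auto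
  qed (use bdd \<open>K \<noteq> {}\<close> in auto)
  then obtain f where f: "linear f" "\<And>x. f x \<le> p x"
    using hahn_banach_sublinear by blast
  have f_le: "f x \<le> norm (x + t *\<^sub>R k) - t * d" if "t \<ge> 0" "k \<in> K" for x t k
  proof -
    have "p x \<le> F (t, k) x"
      unfolding p_def using that by (intro cINF_lower bdd) auto
    with f(2)[of x] show ?thesis by (simp add: F_def)
  qed
  obtain k0 where "k0 \<in> K" using \<open>K \<noteq> {}\<close> by auto
  then have le: "f x \<le> norm x" for x
    using f_le[of 0 k0 x] by simp
  show thesis
  proof
    show "\<bar>f x\<bar> \<le> norm x" for x
      using le[of x] le[of "- x"] by (simp add: linear_neg[OF f(1)])
    show "d \<le> f k" if "k \<in> K" for k
      using f_le[of 1 k "- k"] that by (simp add: linear_neg[OF f(1)])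
  qed (fact f(1))
qed

section \<open>Invariant means and coboundaries\<close>

lemma const_in_LUCB: "(\<lambda>x. c) \<in> LUCB"
  by (auto simp: LUCB_def uniform_limit_iff)

lemma add_in_LUCB:
  assumes "\<phi> \<in> LUCB" "\<psi> \<in> LUCB"
  shows "(\<lambda>x. \<phi> x + \<psi> x) \<in> LUCB"
  using assms bounded_plus_comp[of \<phi> UNIV \<psi>] unfolding LUCB_def
  by (simp add: uniform_limit_add)

text \<open>In \<open>\<pi> (x + h) w\<close> the element x acts last, so its isometry bounds the
  difference of two right translates by \<open>dist (\<pi> h w) (\<pi> g w)\<close>, uniformly in x.
  Strong continuity at g finishes the argument.\<close>

lemma orbit_function_in_LUCB:
  fixes f :: "'v::banach \<Rightarrow> real"
  assumes \<pi>: "linear_isometric_action \<pi>"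
    and f: "linear f" "\<And>x. \<bar>f x\<bar> \<le> norm x"
  shows "(\<lambda>g. f (\<pi> g w)) \<in> LUCB"
proof -
  have bounded: "bounded (range (\<lambda>g. f (\<pi> g w)))"
    unfolding bounded_iff
    using f(2)[of "\<pi> _ w"] \<pi> by (auto simp: linear_isometric_action_def)
  have "uniform_limit UNIV (\<lambda>h x. f (\<pi> (x + h) w)) (\<lambda>x. f (\<pi> (x + g) w)) (nhds g)" for g
  proof (rule uniform_limitI)
    fix e :: real assume "e > 0"
    have "((\<lambda>h. \<pi> h w) \<longlongrightarrow> \<pi> g w) (nhds g)"
      using \<pi> unfolding linear_isometric_action_def continuous_on_def
      by (intro tendsto_at_iff_tendsto_nhds[THEN iffD1]) simp
    then have "\<forall>\<^sub>F h in nhds g. dist (\<pi> h w) (\<pi> g w) < e"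
      using \<open>e > 0\<close> by (rule tendstoD)
    then show "\<forall>\<^sub>F h in nhds g. \<forall>x\<in>UNIV. dist (f (\<pi> (x + h) w)) (f (\<pi> (x + g) w)) < e"
    proof (rule eventually_mono, intro ballI)
      fix h x assume h: "dist (\<pi> h w) (\<pi> g w) < e"
      have "f (\<pi> (x + h) w) - f (\<pi> (x + g) w) = f (\<pi> x (\<pi> h w - \<pi> g w))"
        using \<pi> f(1)
        by (simp add: linear_isometric_action_def is_group_action_def linear_diff)
      then have "dist (f (\<pi> (x + h) w)) (f (\<pi> (x + g) w)) \<le> norm (\<pi> x (\<pi> h w - \<pi> g w))"
        using f(2) by (simp add: dist_real_def)
      also have "\<dots> = dist (\<pi> h w) (\<pi> g w)"
        using \<pi> by (simp add: linear_isometric_action_def dist_norm)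
      finally show "dist (f (\<pi> (x + h) w)) (f (\<pi> (x + g) w)) < e"
        using h by simp
    qed
  qed
  with bounded show ?thesis by (simp add: LUCB_def)
qed

lemma mean_orbit_function_eq_0:
  fixes m :: "('g::topological_group_add \<Rightarrow> real) \<Rightarrow> real" and f :: "'v::banach \<Rightarrow> real"
  assumes m: "mean_on_LUCB m" "\<And>\<phi> g. \<phi> \<in> LUCB \<Longrightarrow> m (\<lambda>x. \<phi> (x + g)) = m \<phi>"
    and \<pi>: "linear_isometric_action \<pi>"
    and f: "linear f" "\<And>x. \<bar>f x\<bar> \<le> norm x"
    and w: "w \<in> coboundary_space \<pi>"
  shows "m (\<lambda>g. f (\<pi> g w)) = 0"
proof -
  define L where "L w = m (\<lambda>g. f (\<pi> g w))" for w
  have in_LUCB: "(\<lambda>g. f (\<pi> g w)) \<in> LUCB" for w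
    using \<pi> f by (rule orbit_function_in_LUCB)
  have lin: "linear (\<pi> g)" and iso: "norm (\<pi> g w) = norm w"
    and act: "\<pi> (g + h) w = \<pi> g (\<pi> h w)" for g h w
    using \<pi> by (auto simp: linear_isometric_action_def is_group_action_def)
  have "linear L"
  proof (rule linearI)
    show "L (v + w) = L v + L w" for v w
      using m(1) in_LUCB
      by (simp add: L_def mean_on_LUCB_def linear_add[OF lin] linear_add[OF f(1)])
    show "L (c *\<^sub>R w) = c *\<^sub>R L w" for c w
      using m(1) in_LUCB
      by (simp add: L_def mean_on_LUCB_def linear_cmul[OF lin] linear_cmul[OF f(1)])
  qed
  \<comment> \<open>Averaging keeps the norm at most 1: the action is isometric and the mean is
    bounded by the supremum.\<close>
  moreover have "norm (L w) \<le> norm w * 1" for w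
  proof -
    have "\<bar>L w\<bar> \<le> (SUP g. \<bar>f (\<pi> g w)\<bar>)"
      using m(1) in_LUCB by (simp add: L_def mean_on_LUCB_def)
    also have "\<dots> \<le> norm w"
      using f(2)[of "\<pi> _ w"] by (intro cSUP_least) (auto simp: iso)
    finally show ?thesis by simp
  qed
  ultimately have "bounded_linear L"
    by (simp add: bounded_linear.intro bounded_linear_axioms.intro exI[of _ 1])
  then have cont: "continuous_on UNIV L"
    by (rule linear_continuous_on)
  \<comment> \<open>The orbit function of \<open>\<pi> g v\<close> is the right translate by g of
    that of v, so both have the same mean.\<close>
  have "L (v - \<pi> g v) = 0" for v g
    using m(2)[OF in_LUCB[of v], of g]
    by (simp add: linear_diff[OF \<open>linear L\<close>]) (simp add: L_def act)
  then have "L u = 0" if "u \<in> span {v - \<pi> g v | v g. True}" for u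
    using linear_eq_0_on_span[OF \<open>linear L\<close> _ that] by blast
  then have "span {v - \<pi> g v | v g. True} \<subseteq> {u. L u = 0}"
    by blast
  moreover have "closed {u. L u = 0}"
    using cont by (intro closed_Collect_eq continuous_on_const)
  ultimately have "coboundary_space \<pi> \<subseteq> {u. L u = 0}"
    unfolding coboundary_space_def by (rule closure_minimal)
  with w show ?thesis by (auto simp: L_def)
qed

section \<open>Invariant convex sets\<close>

lemma invariant_convex_small_norm:
  fixes \<pi> :: "'g::topological_group_add \<Rightarrow> 'v::banach \<Rightarrow> 'v"
  assumes "amenable TYPE('g)" and \<pi>: "linear_isometric_action \<pi>"
    and K: "convex K" "K \<noteq> {}" "action_invariant \<pi> K" "K \<subseteq> coboundary_space \<pi>"
    and "\<epsilon> > 0"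
  shows "\<exists>k\<in>K. norm k < \<epsilon>"
proof (rule ccontr)
  assume "\<not> (\<exists>k\<in>K. norm k < \<epsilon>)"
  then have "\<epsilon> \<le> norm k" if "k \<in> K" for k
    using that by force
  then obtain f where f: "linear f" "\<And>x. \<bar>f x\<bar> \<le> norm x" "\<And>k. k \<in> K \<Longrightarrow> \<epsilon> \<le> f k"
    using separate_convex_from_ball[OF K(1,2)] by blast
  obtain m :: "('g \<Rightarrow> real) \<Rightarrow> real" where
    m: "mean_on_LUCB m" "\<And>\<phi> g. \<phi> \<in> LUCB \<Longrightarrow> m (\<lambda>x. \<phi> (x + g)) = m \<phi>"
    using \<open>amenable TYPE('g)\<close> by (auto simp: amenable_def)
  obtain k where "k \<in> K" using K(2) by auto
  let ?\<phi> = "\<lambda>g. f (\<pi> g k)"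
  have mean_0: "m ?\<phi> = 0"
    using m \<pi> f(1,2) by (rule mean_orbit_function_eq_0) (use \<open>k \<in> K\<close> K(4) in auto)
  have in_LUCB: "?\<phi> \<in> LUCB"
    using \<pi> f(1,2) by (rule orbit_function_in_LUCB)
  have m_add: "m (\<lambda>x. \<phi> x + \<psi> x) = m \<phi> + m \<psi>" if "\<phi> \<in> LUCB" "\<psi> \<in> LUCB" for \<phi> \<psi>
    using m(1) that by (simp add: mean_on_LUCB_def)
  \<comment> \<open>The mean is normalised at the constant 1; homogeneity extends this to every
    constant.\<close>
  have m_const: "m (\<lambda>x. c) = c" for c
  proof -
    have "\<forall>c. \<forall>\<phi>\<in>LUCB. m (\<lambda>x. c * \<phi> x) = c * m \<phi>" "m (\<lambda>x. 1) = 1"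
      using m(1) by (simp_all add: mean_on_LUCB_def)
    from this(1)[rule_format, OF const_in_LUCB, of c 1] this(2) show ?thesis by simp
  qed
  \<comment> \<open>The orbit of k stays in K, so subtracting \<epsilon> leaves a non-negative
    function; positivity and additivity of the mean then replace monotonicity.\<close>
  have "(\<lambda>g. ?\<phi> g + - \<epsilon>) \<in> LUCB"
    using in_LUCB const_in_LUCB by (rule add_in_LUCB)
  moreover have "0 \<le> ?\<phi> g + - \<epsilon>" for g
    using f(3) \<open>k \<in> K\<close> K(3) by (force simp: action_invariant_def)
  ultimately have "0 \<le> m (\<lambda>g. ?\<phi> g + - \<epsilon>)"
    using m(1) by (simp add: mean_on_LUCB_def)
  also have "\<dots> = - \<epsilon>"
    unfolding m_add[OF in_LUCB const_in_LUCB] mean_0 m_const by simp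
  finally show False using \<open>\<epsilon> > 0\<close> by simp
qed

text \<open>This keeps C - D inside the space on which means of orbit functions vanish.\<close>

lemma coboundary_space_diff:
  assumes "x \<in> coboundary_space \<pi>" "y \<in> coboundary_space \<pi>"
  shows "x - y \<in> coboundary_space \<pi>"
proof -
  let ?S = "span {v - \<pi> g v | v g. True}"
  obtain X Y where "\<And>n. X n \<in> ?S" "X \<longlonglongrightarrow> x" "\<And>n. Y n \<in> ?S" "Y \<longlonglongrightarrow> y"
    using assms unfolding coboundary_space_def closure_sequential by blast
  then have "\<forall>n. X n - Y n \<in> ?S" "(\<lambda>n. X n - Y n) \<longlonglongrightarrow> x - y"
    by (auto intro: span_diff tendsto_diff)
  then show ?thesis
    unfolding coboundary_space_def closure_sequential
    by (intro exI[of _ "\<lambda>n. X n - Y n"] conjI)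
qed

text \<open>The cocycle cancels in differences. Hence the difference set of two \<alpha>-invariant
  sets is \<pi>-invariant.\<close>

lemma associated_linear_action_diff:
  assumes "associated_linear_action \<alpha> \<pi>"
  shows "\<alpha> g x - \<alpha> g y = \<pi> g (x - y)"
proof -
  obtain b where "linear (\<pi> g)" "\<And>g v. \<alpha> g v = \<pi> g v + b g"
    using assms by (auto simp: associated_linear_action_def linear_isometric_action_def)
  then show ?thesis by (simp add: linear_diff)
qed

lemma invariant_convex_pair_close:
  fixes \<alpha> \<pi> :: "'g::topological_group_add \<Rightarrow> 'v::banach \<Rightarrow> 'v"
  assumes "amenable TYPE('g)" and \<pi>: "associated_linear_action \<alpha> \<pi>"
    and C: "convex C" "C \<noteq> {}" "action_invariant \<alpha> C" "C \<subseteq> coboundary_space \<pi>"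
    and D: "convex D" "D \<noteq> {}" "action_invariant \<alpha> D" "D \<subseteq> coboundary_space \<pi>"
    and "\<epsilon> > 0"
  shows "\<exists>x\<in>C. \<exists>y\<in>D. dist x y < \<epsilon>"
proof -
  define K where "K = (\<Union>x\<in>C. \<Union>y\<in>D. {x - y})"
  have "linear_isometric_action \<pi>"
    using \<pi> by (simp add: associated_linear_action_def)
  moreover have "convex K"
    unfolding K_def using C(1) D(1) by (rule convex_differences)
  moreover have "K \<noteq> {}"
    using C(2) D(2) by (auto simp: K_def)
  moreover have "action_invariant \<pi> K"
    unfolding action_invariant_def
  proof (intro allI subsetI)
    fix g z assume "z \<in> \<pi> g ` K"
    then obtain x y where "x \<in> C" "y \<in> D" "z = \<alpha> g x - \<alpha> g y"
      by (auto simp: K_def associated_linear_action_diff[OF \<pi>])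
    moreover from this have "\<alpha> g x \<in> C" "\<alpha> g y \<in> D"
      using C(3) D(3) unfolding action_invariant_def by blast+
    ultimately show "z \<in> K"
      by (auto simp: K_def)
  qed
  moreover have "K \<subseteq> coboundary_space \<pi>"
    using C(4) D(4) by (auto simp: K_def intro!: coboundary_space_diff)
  ultimately have "\<exists>k\<in>K. norm k < \<epsilon>"
    using invariant_convex_small_norm[OF assms(1)] \<open>\<epsilon> > 0\<close> by blast
  then show ?thesis by (auto simp: K_def dist_norm)
qed

text \<open>The set is C intersected with the open \<epsilon>-neighbourhood of D, and that
  neighbourhood is the Minkowski sum of D and a ball.\<close>

lemma convex_close_points:
  fixes C D :: "'v::real_normed_vector set"
  assumes "convex C" "convex D"
  shows "convex {x \<in> C. \<exists>y\<in>D. dist x y < \<epsilon>}"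
proof -
  have "{x \<in> C. \<exists>y\<in>D. dist x y < \<epsilon>} = C \<inter> (\<Union>y\<in>D. \<Union>z\<in>ball 0 \<epsilon>. {y + z})"
  proof (intro set_eqI iffI)
    fix x assume "x \<in> {x \<in> C. \<exists>y\<in>D. dist x y < \<epsilon>}"
    then obtain y where "x \<in> C" "y \<in> D" "dist x y < \<epsilon>" by auto
    moreover from this have "x = y + (x - y)" "x - y \<in> ball 0 \<epsilon>"
      by (auto simp: dist_norm norm_minus_commute)
    ultimately show "x \<in> C \<inter> (\<Union>y\<in>D. \<Union>z\<in>ball 0 \<epsilon>. {y + z})" by blast
  next
    fix x assume "x \<in> C \<inter> (\<Union>y\<in>D. \<Union>z\<in>ball 0 \<epsilon>. {y + z})"
    then obtain y z where "x \<in> C" "y \<in> D" "norm z < \<epsilon>" "x = y + z" by auto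
    moreover from this have "dist x y < \<epsilon>" by (simp add: dist_norm)
    ultimately show "x \<in> {x \<in> C. \<exists>y\<in>D. dist x y < \<epsilon>}" by blast
  qed
  then show ?thesis
    using assms by (simp only:) (intro convex_Int convex_sums convex_ball)
qed

text \<open>Induction on I with D arbitrary: each step shrinks D to its points close to one more
  \<open>C j\<close>, so a point found in the smaller set inherits that closeness and still lies in
  D.\<close>

lemma finite_family_close:
  fixes \<alpha> \<pi> :: "'g::topological_group_add \<Rightarrow> 'v::banach \<Rightarrow> 'v"
  assumes "amenable TYPE('g)" and \<pi>: "associated_linear_action \<alpha> \<pi>"
    and "\<And>g x y. dist (\<alpha> g x) (\<alpha> g y) = dist x y"
    and "finite I"
    and "\<And>i. i \<in> I \<Longrightarrow> C i \<noteq> {} \<and> convex (C i) \<and> action_invariant \<alpha> (C i) \<and>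
           C i \<subseteq> coboundary_space \<pi>"
    and "\<epsilon> > 0"
    and "convex D" "D \<noteq> {}" "action_invariant \<alpha> D" "D \<subseteq> coboundary_space \<pi>"
  shows "\<exists>x\<in>D. \<forall>i\<in>I. \<exists>y\<in>C i. dist x y < \<epsilon>"
  using assms(4,5,7-)
proof (induction I arbitrary: D rule: finite_induct)
  case empty
  then show ?case by auto
next
  case (insert j J)
  let ?D = "{x \<in> D. \<exists>y\<in>C j. dist x y < \<epsilon>}"
  have "\<exists>x\<in>?D. \<forall>i\<in>J. \<exists>y\<in>C i. dist x y < \<epsilon>"
  proof (rule insert.IH)
    show "?D \<noteq> {}"
      using invariant_convex_pair_close[OF assms(1) \<pi>, of D "C j" \<epsilon>] insert.prems \<open>\<epsilon> > 0\<close>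
      by auto
    show "convex ?D"
      using insert.prems by (intro convex_close_points) auto
    have "action_invariant \<alpha> (C j)"
      using insert.prems by simp
    \<comment> \<open>A witness y for x is carried along to \<open>\<alpha> g y\<close> for
      \<open>\<alpha> g x\<close>, at the same distance.\<close>
    then have "\<exists>y\<in>C j. dist (\<alpha> g x) y < \<epsilon>" if "y \<in> C j" "dist x y < \<epsilon>" for g x y
      using that assms(3)[of g x y] by (intro bexI[of _ "\<alpha> g y"]) (auto simp: action_invariant_def)
    moreover have "\<alpha> g x \<in> D" if "x \<in> D" for g x
      using \<open>action_invariant \<alpha> D\<close> that by (auto simp: action_invariant_def)
    ultimately show "action_invariant \<alpha> ?D"
      unfolding action_invariant_def by blast
  qed (use insert.prems in auto)
  then show ?case by auto
qed

theorem corollary1p8: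
  fixes \<alpha> \<pi> :: "'g::topological_group_add \<Rightarrow> 'v::banach \<Rightarrow> 'v"
    and C :: "nat \<Rightarrow> 'v set" and n :: nat and \<epsilon> :: real
  assumes "amenable TYPE('g)"
    and "\<And>h :: 'g \<Rightarrow> real. continuous_hom_to_real h \<Longrightarrow> h = (\<lambda>g. 0)"
    and "continuous_affine_isometric_action \<alpha>"
    and "associated_linear_action \<alpha> \<pi>"
    and "n \<ge> 1"
    and "\<And>i. i \<in> {1..n} \<Longrightarrow> C i \<noteq> {}"
    and "\<And>i. i \<in> {1..n} \<Longrightarrow> convex (C i)"
    and "\<And>i. i \<in> {1..n} \<Longrightarrow> action_invariant \<alpha> (C i)"
    and "\<And>i. i \<in> {1..n} \<Longrightarrow> C i \<subseteq> coboundary_space \<pi>"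
    and "\<epsilon> > 0"
  shows "\<exists>v \<in> coboundary_space \<pi>. (MAX i\<in>{1..n}. infdist v (C i)) < \<epsilon>"
proof -
  have "dist (\<alpha> g x) (\<alpha> g y) = dist x y" for g x y
    using assms(3) by (auto simp: continuous_affine_isometric_action_def affine_isometry_def)
  \<comment> \<open>The induction starts from D = \<open>C 1\<close>, present because n \<ge> 1;
    this also places v in the closed span.\<close>
  then have "\<exists>v\<in>C 1. \<forall>i\<in>{1..n}. \<exists>y\<in>C i. dist v y < \<epsilon>"
    using assms(5-) by (intro finite_family_close[OF assms(1,4)]) auto
  then obtain v where v: "v \<in> C 1" "\<And>i. i \<in> {1..n} \<Longrightarrow> \<exists>y\<in>C i. dist v y < \<epsilon>"
    by blast
  have "infdist v (C i) < \<epsilon>" if "i \<in> {1..n}" for i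
    using v(2)[OF that] infdist_le by (meson le_less_trans)
  \<comment> \<open>Strict bounds pass to the maximum because the index set is finite and
    non-empty.\<close>
  then have "(MAX i\<in>{1..n}. infdist v (C i)) < \<epsilon>"
    using \<open>n \<ge> 1\<close> by (subst Max_less_iff) auto
  moreover have "v \<in> coboundary_space \<pi>"
    using v(1) assms(9)[of 1] \<open>n \<ge> 1\<close> by auto
  ultimately show ?thesis by blast
qed

end
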